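(* Consider the control-affine system $\dot x = f(x)+g(x)u$ with target set $\mathcal{C}=\{x\in\mathbb{R}^n: h(x)\ge 0\}$, deadline $T>0$, initial condition $x(0)\in\mathbb{R}^n$ and relaxation schedule $r$ (all as in the context). Let $\tilde h(x,t)=h(x)+r(x(0),t)$ be a constricting CBF for $\mathcal{C}$ on $[0,T]$ with relaxation schedule $r$ and initial condition $x(0)$, and let $\gamma$ be an extended class-$\mathcal{K}$ function as in the definition of constricting CBF. Then any locally Lipschitz feedback controller $u=\kappa(x,t)$ satisfying $$L_f h(x)+L_g h(x)\,\kappa(x,t)+\dot r(x(0),t)\ \ge\ -\gamma\bigl(\tilde h(x,t)\bigr)$$ for all $(x,t)\in\tilde{\mathcal{C}}(t)\times[0,T]$ (that is, for all $t\in[0,T]$ and all $x\in\tilde{\mathcal{C}}(t)$) renders $\tilde{\mathcal{C}}(t)$ forward invariant on $[0,T]$ and ensures: (i) (prescribed-time recovery) $x(T)\in\mathcal{C}$; (ii) (forward invariance) $x(t)\in\mathcal{C}$ for all $t\ge T$, where $x(t)$ is the closed-loop trajectory starting at $x(0)$.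
   Context: System: $\dot x=f(x)+g(x)u$ with state $x\in\mathbb{R}^n$, control $u\in\mathcal{U}$, where $\mathcal{U}\subset\mathbb{R}^m$ is a set of admissible inputs, and $f:\mathbb{R}^n\to\mathbb{R}^n$, $g:\mathbb{R}^n\to\mathbb{R}^{n\times m}$ are locally Lipschitz. The function $h:\mathbb{R}^n\to\mathbb{R}$ is continuously differentiable, $\mathcal{C}=\{x:h(x)\ge0\}$, and $L_fh(x)=\nabla h(x)^\top f(x)$, $L_gh(x)=\nabla h(x)^\top g(x)$ (a row vector). Extended class-$\mathcal{K}$ function: a continuous strictly increasing function $\gamma:\mathbb{R}\to\mathbb{R}$ with $\gamma(0)=0$. Standing assumptions: (a) $h$ is a control barrier function (CBF) for $\mathcal{C}$: there exists an extended class-$\mathcal{K}$ function $\gamma$ such that for all $x\in\mathbb{R}^n$, $\sup_{u\in\mathbb{R}^m}[L_fh(x)+L_gh(x)u]\ge-\gamma(h(x))$; (b) $L_gh(x)\ne0$ for all $x\in\partial\mathcal{C}$. Constricting tube and relaxation schedule: given $h$, $x(0)$ and $T>0$, set $r_0=\max\{0,-h(x(0))\}$. A relaxation schedule is a function $r:\mathbb{R}^n\times[0,T]\to\mathbb{R}_{\ge0}$, $\mathcal{C}^1$ in $t$ (with $\dot r$ denoting the derivative in $t$), such that $r(x(0),0)=r_0$, $r(x(0),T)=0$, and $\dot r(x(0),t)\le0$ for all $t\in[0,T]$. The tube function $\tilde h:\mathbb{R}^n\times[0,T]\to\mathbb{R}$ is $\tilde h(x,t)=h(x)+r(x(0),t)$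 and the constricting tube is $\tilde{\mathcal{C}}(t)=\{x\in\mathbb{R}^n:\tilde h(x,t)\ge0\}$; it satisfies $x(0)\in\tilde{\mathcal{C}}(0)$ and $\tilde{\mathcal{C}}(T)=\mathcal{C}$. Constricting CBF: $\tilde h$ is a constricting CBF for $\mathcal{C}$ on $[0,T]$, with relaxation schedule $r$ and initial condition $x(0)$, if there exists an extended class-$\mathcal{K}$ function $\gamma$ such that for all $(x,t)\in\tilde{\mathcal{C}}(t)\times[0,T]$, $$\sup_{u\in\mathcal{U}}\{L_fh(x)+L_gh(x)u+\dot r(x(0),t)\}\ge-\gamma(\tilde h(x,t)).$$ Forward invariance of $\tilde{\mathcal{C}}(t)$ on $[0,T]$ means that closed-loop trajectories starting in $\tilde{\mathcal{C}}(0)$ at time $0$ satisfy $x(t)\in\tilde{\mathcal{C}}(t)$ for all $t\in[0,T]$.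
   Formalization: Clause (ii) fails if the controller is arbitrary after T; it is proved for the controller held at κ(x,T) after T, and for any admissible locally Lipschitz extension of κ to t>T keeping L_f h+L_g h u ≥ −γ(h) on C. Trajectories are considered for as long as they exist. *)

theory Defs
  imports "HOL-Analysis.Analysis"
begin

text \<open>States live in \<^typ>\<open>real ^ 'n\<close>, inputs in \<^typ>\<open>real ^ 'm\<close>; the input matrix
  \<open>g x\<close> is an \<open>n \<times> m\<close> matrix, of type \<^typ>\<open>real ^ 'm ^ 'n\<close>.\<close>

definition locally_lipschitz_on ::
    "'a::metric_space set \<Rightarrow> ('a \<Rightarrow> 'b::metric_space) \<Rightarrow> bool" where
  "locally_lipschitz_on S F \<longleftrightarrow> (\<forall>p\<in>S. \<exists>e>0. \<exists>L. L-lipschitz_on (cball p e \<inter> S) F)"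

definition grad :: "(real ^ 'n \<Rightarrow> real) \<Rightarrow> real ^ 'n \<Rightarrow> real ^ 'n" where
  "grad h x = (THE D. GDERIV h x :> D)"

lemma grad_eqI:
  assumes "GDERIV h x :> D"
  shows "grad h x = D"
  unfolding grad_def
proof (rule the_equality)
  show "GDERIV h x :> D" by (fact assms)
next
  fix D' assume "GDERIV h x :> D'"
  from this assms have "(\<lambda>v. v \<bullet> D') = (\<lambda>v. v \<bullet> D)"
    unfolding gderiv_def by (rule has_derivative_unique)
  then have "\<forall>v. v \<bullet> D' = v \<bullet> D" by (simp add: fun_eq_iff)
  then show "D' = D" by (simp only: vector_eq_ldot)
qed

definition continuously_differentiable :: "(real ^ 'n \<Rightarrow> real) \<Rightarrow> bool" where
  "continuously_differentiable h \<longleftrightarrow>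
     (\<forall>x. h differentiable (at x)) \<and> continuous_on UNIV (grad h)"

definition Lie_f :: "(real ^ 'n \<Rightarrow> real ^ 'n) \<Rightarrow> (real ^ 'n \<Rightarrow> real) \<Rightarrow> real ^ 'n \<Rightarrow> real" where
  "Lie_f f h x = grad h x \<bullet> f x"

text \<open>The row vector \<open>\<nabla>h(x)\<^sup>T g(x)\<close>; it acts on an input \<open>u\<close> as \<open>Lie_g g h x \<bullet> u\<close>.\<close>

definition Lie_g ::
    "(real ^ 'n \<Rightarrow> real ^ 'm ^ 'n) \<Rightarrow> (real ^ 'n \<Rightarrow> real) \<Rightarrow> real ^ 'n \<Rightarrow> real ^ 'm" where
  "Lie_g g h x = grad h x v* g x"

definition extended_class_K :: "(real \<Rightarrow> real) \<Rightarrow> bool" where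
  "extended_class_K \<gamma> \<longleftrightarrow> continuous_on UNIV \<gamma> \<and> strict_mono \<gamma> \<and> \<gamma> 0 = 0"

definition target_set :: "(real ^ 'n \<Rightarrow> real) \<Rightarrow> (real ^ 'n) set" where
  "target_set h = {x. h x \<ge> 0}"

text \<open>Suprema over inputs are taken in the extended reals, since the set of values is in general
  unbounded above (and the supremum over an empty input set is \<open>-\<infinity>\<close>).\<close>

definition control_barrier_function ::
    "(real ^ 'n \<Rightarrow> real ^ 'n) \<Rightarrow> (real ^ 'n \<Rightarrow> real ^ 'm ^ 'n) \<Rightarrow> (real ^ 'n \<Rightarrow> real) \<Rightarrow> bool" where
  "control_barrier_function f g h \<longleftrightarrow>
     (\<exists>\<gamma>. extended_class_K \<gamma> \<and>
        (\<forall>x. (SUP u::real ^ 'm. ereal (Lie_f f h x + Lie_g g h x \<bullet> u)) \<ge> ereal (- \<gamma> (h x))))"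

text \<open>The derivative of a schedule in time; one-sided at the end points of \<open>[0, T]\<close>.\<close>

definition rdot :: "real \<Rightarrow> (real ^ 'n \<Rightarrow> real \<Rightarrow> real) \<Rightarrow> real ^ 'n \<Rightarrow> real \<Rightarrow> real" where
  "rdot T r x t = vector_derivative (r x) (at t within {0..T})"

definition relaxation_schedule ::
    "(real ^ 'n \<Rightarrow> real) \<Rightarrow> real ^ 'n \<Rightarrow> real \<Rightarrow> (real ^ 'n \<Rightarrow> real \<Rightarrow> real) \<Rightarrow> bool" where
  "relaxation_schedule h x0 T r \<longleftrightarrow>
     (\<forall>x. \<forall>t\<in>{0..T}. r x t \<ge> 0) \<and>
     (\<forall>x. (\<forall>t\<in>{0..T}. r x differentiable (at t within {0..T})) \<and>
          continuous_on {0..T} (rdot T r x)) \<and>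
     r x0 0 = max 0 (- h x0) \<and>
     r x0 T = 0 \<and>
     (\<forall>t\<in>{0..T}. rdot T r x0 t \<le> 0)"

definition tube_fun ::
    "(real ^ 'n \<Rightarrow> real) \<Rightarrow> (real ^ 'n \<Rightarrow> real \<Rightarrow> real) \<Rightarrow> real ^ 'n \<Rightarrow> real ^ 'n \<Rightarrow> real \<Rightarrow> real" where
  "tube_fun h r x0 x t = h x + r x0 t"

definition tube ::
    "(real ^ 'n \<Rightarrow> real) \<Rightarrow> (real ^ 'n \<Rightarrow> real \<Rightarrow> real) \<Rightarrow> real ^ 'n \<Rightarrow> real \<Rightarrow> (real ^ 'n) set" where
  "tube h r x0 t = {x. tube_fun h r x0 x t \<ge> 0}"

definition constricting_cbf_with ::
    "(real \<Rightarrow> real) \<Rightarrow> (real ^ 'm) set \<Rightarrow> (real ^ 'n \<Rightarrow> real ^ 'n) \<Rightarrow> (real ^ 'n \<Rightarrow> real ^ 'm ^ 'n) \<Rightarrow>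
     (real ^ 'n \<Rightarrow> real) \<Rightarrow> real \<Rightarrow> (real ^ 'n \<Rightarrow> real \<Rightarrow> real) \<Rightarrow> real ^ 'n \<Rightarrow> bool" where
  "constricting_cbf_with \<gamma> U f g h T r x0 \<longleftrightarrow>
     extended_class_K \<gamma> \<and>
     (\<forall>t\<in>{0..T}. \<forall>x\<in>tube h r x0 t.
        (SUP u\<in>U. ereal (Lie_f f h x + Lie_g g h x \<bullet> u + rdot T r x0 t))
          \<ge> ereal (- \<gamma> (tube_fun h r x0 x t)))"

definition constricting_cbf ::
    "(real ^ 'm) set \<Rightarrow> (real ^ 'n \<Rightarrow> real ^ 'n) \<Rightarrow> (real ^ 'n \<Rightarrow> real ^ 'm ^ 'n) \<Rightarrow>
     (real ^ 'n \<Rightarrow> real) \<Rightarrow> real \<Rightarrow> (real ^ 'n \<Rightarrow> real \<Rightarrow> real) \<Rightarrow> real ^ 'n \<Rightarrow> bool" where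
  "constricting_cbf U f g h T r x0 \<longleftrightarrow> (\<exists>\<gamma>. constricting_cbf_with \<gamma> U f g h T r x0)"

text \<open>A time-varying feedback with admissible values, locally Lipschitz jointly in state and time;
  only its values for times in \<open>I\<close> matter.\<close>

definition feedback_controller ::
    "(real ^ 'm) set \<Rightarrow> real set \<Rightarrow> (real ^ 'n \<Rightarrow> real \<Rightarrow> real ^ 'm) \<Rightarrow> bool" where
  "feedback_controller U I \<kappa> \<longleftrightarrow>
     locally_lipschitz_on (UNIV \<times> I) (\<lambda>(x, t). \<kappa> x t) \<and> (\<forall>x. \<forall>t\<in>I. \<kappa> x t \<in> U)"

text \<open>A closed-loop trajectory on a time interval \<open>J\<close> starting at time 0. Locally Lipschitz data do
  not exclude finite escape time, so \<open>J\<close> may be any interval, bounded or not, containing 0.\<close>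

definition closed_loop_trajectory ::
    "(real ^ 'n \<Rightarrow> real ^ 'n) \<Rightarrow> (real ^ 'n \<Rightarrow> real ^ 'm ^ 'n) \<Rightarrow>
     (real ^ 'n \<Rightarrow> real \<Rightarrow> real ^ 'm) \<Rightarrow> real set \<Rightarrow> (real \<Rightarrow> real ^ 'n) \<Rightarrow> bool" where
  "closed_loop_trajectory f g \<kappa> J x \<longleftrightarrow>
     is_interval J \<and> 0 \<in> J \<and> J \<subseteq> {0..} \<and>
     (\<forall>t\<in>J. (x has_vector_derivative (f (x t) + g (x t) *v \<kappa> (x t) t)) (at t within J))"

definition forward_invariant_on ::
    "(real ^ 'n \<Rightarrow> real ^ 'n) \<Rightarrow> (real ^ 'n \<Rightarrow> real ^ 'm ^ 'n) \<Rightarrow>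
     (real ^ 'n \<Rightarrow> real \<Rightarrow> real ^ 'm) \<Rightarrow> real \<Rightarrow> (real \<Rightarrow> (real ^ 'n) set) \<Rightarrow> bool" where
  "forward_invariant_on f g \<kappa> T S \<longleftrightarrow>
     (\<forall>J x. closed_loop_trajectory f g \<kappa> J x \<and> J \<subseteq> {0..T} \<and> x 0 \<in> S 0 \<longrightarrow> (\<forall>t\<in>J. x t \<in> S t))"

text \<open>Beyond the deadline a feedback designed on \<open>[0, T]\<close> has to be continued. The canonical
  continuation freezes it at its final value.\<close>

definition hold_after ::
    "real \<Rightarrow> (real ^ 'n \<Rightarrow> real \<Rightarrow> real ^ 'm) \<Rightarrow> real ^ 'n \<Rightarrow> real \<Rightarrow> real ^ 'm" where
  "hold_after T \<kappa> x t = \<kappa> x (min t T)"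

text \<open>More generally, a continuation may be any admissible locally Lipschitz feedback on
  \<open>[0, \<infinity>)\<close> extending \<open>\<kappa>\<close> that keeps satisfying the tube condition with the schedule continued
  by zero (so that the tube stays equal to the target set and the tube function to \<open>h\<close>).\<close>

definition barrier_continuation ::
    "(real \<Rightarrow> real) \<Rightarrow> (real ^ 'm) set \<Rightarrow> (real ^ 'n \<Rightarrow> real ^ 'n) \<Rightarrow> (real ^ 'n \<Rightarrow> real ^ 'm ^ 'n) \<Rightarrow>
     (real ^ 'n \<Rightarrow> real) \<Rightarrow> real \<Rightarrow> (real ^ 'n \<Rightarrow> real \<Rightarrow> real ^ 'm) \<Rightarrow>
     (real ^ 'n \<Rightarrow> real \<Rightarrow> real ^ 'm) \<Rightarrow> bool" where
  "barrier_continuation \<gamma> U f g h T \<kappa> \<mu> \<longleftrightarrow>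
     feedback_controller U {0..} \<mu> \<and>
     (\<forall>x. \<forall>t\<in>{0..T}. \<mu> x t = \<kappa> x t) \<and>
     (\<forall>t>T. \<forall>x\<in>target_set h. Lie_f f h x + Lie_g g h x \<bullet> \<mu> x t \<ge> - \<gamma> (h x))"

end

theory Submission
  imports Defs
begin

text \<open>
  Along a closed-loop trajectory the time derivative of \<open>tube_fun h r x0 (x t) t\<close> is exactly
  \<open>Lie_f f h x + Lie_g g h x \<bullet> \<kappa> x t + rdot T r x0 t\<close>, and on the boundary of the tube the
  controller makes it nonnegative, because \<open>\<gamma> 0 = 0\<close>. This is a tangency condition of Nagumo type,
  and it is only known inside the tube; it is not strict, and \<open>\<gamma>\<close> is merely continuous, so a
  differential inequality for the tube function is not enough. Invariance comes from two further
  ingredients.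

  The first is that the closed-loop field is Lipschitz (\<open>closed_loop_locally_lipschitz\<close>). Near a
  boundary point with nonzero gradient \<open>v\<close>, the trajectory is compared with its translate by
  \<open>\<epsilon> exp (K (t - a)) v\<close>. For large \<open>K\<close> this translate enters the tube strictly whenever it meets
  the boundary, hence never leaves; then \<open>\<epsilon> \<rightarrow> 0\<close> (\<open>tube_invariance_at_regular_point\<close>). Only the
  given trajectory is used, not the solvability of perturbed differential equations.

  The second is that boundary points of the tube are regular points of \<open>h\<close> or harmless
  (\<open>cbf_regular\<close>). Since the schedule is nonnegative, they lie at levels \<open>h \<le> 0\<close>. The control
  barrier property excludes critical points at negative levels, and \<open>Lie_g g h \<noteq> 0\<close> on the frontier
  excludes them at level \<open>0\<close> except in the interior of the target set, where there is nothing to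
  prove. A supremum argument then yields invariance on whole intervals (\<open>tube_invariance\<close>).

  Applied with the schedule on \<open>[0, T]\<close> this gives invariance of the tube and recovery at the
  deadline, where the tube is the target set. Applied with the zero schedule from \<open>T\<close> on it gives
  invariance of the target set under every barrier continuation. Holding the final feedback is one
  of them (\<open>hold_after_barrier_continuation\<close>).
\<close>

section \<open>Locally Lipschitz maps and closed-loop fields\<close>

lemma locally_lipschitz_on_subset:
  assumes "locally_lipschitz_on S F" and "R \<subseteq> S"
  shows "locally_lipschitz_on R F"
  unfolding locally_lipschitz_on_def
proof
  fix p assume "p \<in> R"
  then obtain e L where e: "e > 0" and L: "L-lipschitz_on (cball p e \<inter> S) F"
    using assms unfolding locally_lipschitz_on_def by blast
  have "L-lipschitz_on (cball p e \<inter> R) F"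
    using L by (rule lipschitz_on_subset) (use assms(2) in blast)
  then show "\<exists>e>0. \<exists>L. L-lipschitz_on (cball p e \<inter> R) F" using e by blast
qed

lemma locally_lipschitz_on_compose:
  assumes F: "locally_lipschitz_on S F" and \<phi>: "M-lipschitz_on R \<phi>" and sub: "\<phi> ` R \<subseteq> S"
  shows "locally_lipschitz_on R (\<lambda>x. F (\<phi> x))"
  unfolding locally_lipschitz_on_def
proof
  fix p assume p: "p \<in> R"
  then obtain e L where e: "e > 0" and L: "L-lipschitz_on (cball (\<phi> p) e \<inter> S) F"
    using F sub unfolding locally_lipschitz_on_def by blast
  have M: "M \<ge> 0" using \<phi> by (rule lipschitz_on_nonneg)
  define d where "d = e / (M + 1)"
  have d: "d > 0" using e M by (simp add: d_def)
  have Md: "M * d \<le> e" using e M by (simp add: d_def field_simps)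
  have \<phi>': "M-lipschitz_on (cball p d \<inter> R) \<phi>"
    using \<phi> by (rule lipschitz_on_subset) blast
  have "\<phi> ` (cball p d \<inter> R) \<subseteq> cball (\<phi> p) e \<inter> S"
  proof
    fix z assume "z \<in> \<phi> ` (cball p d \<inter> R)"
    then obtain y where y: "y \<in> R" "dist p y \<le> d" "z = \<phi> y" by auto
    have "dist (\<phi> p) (\<phi> y) \<le> M * dist p y" using lipschitz_onD[OF \<phi> p y(1)] .
    also have "\<dots> \<le> M * d" using y(2) M by (rule mult_left_mono)
    finally show "z \<in> cball (\<phi> p) e \<inter> S" using Md y sub by auto
  qed
  then have "L-lipschitz_on (\<phi> ` (cball p d \<inter> R)) F" by (rule lipschitz_on_subset[OF L])
  then have "(L * M)-lipschitz_on (cball p d \<inter> R) (\<lambda>x. F (\<phi> x))"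
    using \<phi>' by (intro lipschitz_on_compose2)
  then show "\<exists>e>0. \<exists>L. L-lipschitz_on (cball p e \<inter> R) (\<lambda>x. F (\<phi> x))" using d by blast
qed

lemma locally_lipschitz_on_add:
  fixes F G :: "'a::metric_space \<Rightarrow> 'b::real_normed_vector"
  assumes F: "locally_lipschitz_on S F" and G: "locally_lipschitz_on S G"
  shows "locally_lipschitz_on S (\<lambda>x. F x + G x)"
  unfolding locally_lipschitz_on_def
proof
  fix p assume p: "p \<in> S"
  obtain d L where d: "d > 0" and L: "L-lipschitz_on (cball p d \<inter> S) F"
    using F p unfolding locally_lipschitz_on_def by blast
  obtain e M where e: "e > 0" and M: "M-lipschitz_on (cball p e \<inter> S) G"
    using G p unfolding locally_lipschitz_on_def by blast
  have "L-lipschitz_on (cball p (min d e) \<inter> S) F" "M-lipschitz_on (cball p (min d e) \<inter> S) G"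
    using L M by (auto elim!: lipschitz_on_subset)
  then have "(L + M)-lipschitz_on (cball p (min d e) \<inter> S) (\<lambda>x. F x + G x)"
    by (rule lipschitz_on_add)
  then show "\<exists>e>0. \<exists>L. L-lipschitz_on (cball p e \<inter> S) (\<lambda>x. F x + G x)"
    using d e by (intro exI[of _ "min d e"]) auto
qed

text \<open>Products of Lipschitz maps are only locally Lipschitz, because the constant involves the size
  of the factors; each factor is bounded on a ball by its value at the centre plus its
  oscillation.\<close>

lemma locally_lipschitz_on_bounded_bilinear:
  fixes F :: "'a::metric_space \<Rightarrow> 'b::real_normed_vector"
    and G :: "'a \<Rightarrow> 'c::real_normed_vector"
    and B :: "'b \<Rightarrow> 'c \<Rightarrow> 'd::real_normed_vector"
  assumes B: "bounded_bilinear B"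
    and F: "locally_lipschitz_on S F" and G: "locally_lipschitz_on S G"
  shows "locally_lipschitz_on S (\<lambda>x. B (F x) (G x))"
  unfolding locally_lipschitz_on_def
proof
  fix p assume p: "p \<in> S"
  obtain d L where d: "d > 0" and L: "L-lipschitz_on (cball p d \<inter> S) F"
    using F p unfolding locally_lipschitz_on_def by blast
  obtain e M where e: "e > 0" and M: "M-lipschitz_on (cball p e \<inter> S) G"
    using G p unfolding locally_lipschitz_on_def by blast
  obtain K where K: "K \<ge> 0" "\<And>a b. norm (B a b) \<le> norm a * norm b * K"
    using bounded_bilinear.nonneg_bounded[OF B] by blast
  have L0: "L \<ge> 0" and M0: "M \<ge> 0" using L M by (auto dest: lipschitz_on_nonneg)
  define bF bG where "bF = norm (F p) + L * d" and "bG = norm (G p) + M * e"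
  have bF: "norm (F y) \<le> bF" if "y \<in> cball p d \<inter> S" for y
  proof -
    have "dist (F p) (F y) \<le> L * dist p y" using L p d that by (intro lipschitz_onD[OF L]) auto
    also have "\<dots> \<le> L * d" using that L0 by (intro mult_left_mono) auto
    finally show ?thesis
      unfolding bF_def dist_norm using norm_triangle_ineq2[of "F y" "F p"]
      by (simp add: norm_minus_commute)
  qed
  have bG: "norm (G y) \<le> bG" if "y \<in> cball p e \<inter> S" for y
  proof -
    have "dist (G p) (G y) \<le> M * dist p y" using M p e that by (intro lipschitz_onD[OF M]) auto
    also have "\<dots> \<le> M * e" using that M0 by (intro mult_left_mono) auto
    finally show ?thesis
      unfolding bG_def dist_norm using norm_triangle_ineq2[of "G y" "G p"]
      by (simp add: norm_minus_commute)
  qed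
  have b0: "bF \<ge> 0" "bG \<ge> 0" using L0 M0 d e by (auto simp: bF_def bG_def)
  have "(L * bG * K + bF * M * K)-lipschitz_on (cball p (min d e) \<inter> S) (\<lambda>x. B (F x) (G x))"
  proof (rule lipschitz_onI)
    fix y z assume y: "y \<in> cball p (min d e) \<inter> S" and z: "z \<in> cball p (min d e) \<inter> S"
    have dF: "norm (F y - F z) \<le> L * dist y z"
      using lipschitz_onD[OF L, of y z] y z by (auto simp: dist_norm)
    have dG: "norm (G y - G z) \<le> M * dist y z"
      using lipschitz_onD[OF M, of y z] y z by (auto simp: dist_norm)
    have "B (F y) (G y) - B (F z) (G z) = B (F y - F z) (G y) + B (F z) (G y - G z)"
      by (simp add: bounded_bilinear.diff_left[OF B] bounded_bilinear.diff_right[OF B])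
    then have "dist (B (F y) (G y)) (B (F z) (G z))
        \<le> norm (B (F y - F z) (G y)) + norm (B (F z) (G y - G z))"
      by (simp add: dist_norm norm_triangle_ineq)
    also have "\<dots> \<le> norm (F y - F z) * norm (G y) * K + norm (F z) * norm (G y - G z) * K"
      by (intro add_mono K)
    also have "\<dots> \<le> (L * dist y z) * bG * K + bF * (M * dist y z) * K"
      using dF dG bF[of z] bG[of y] y z K(1) b0 L0 M0
      by (intro add_mono mult_right_mono mult_mono) auto
    finally show "dist (B (F y) (G y)) (B (F z) (G z)) \<le> (L * bG * K + bF * M * K) * dist y z"
      by (simp add: algebra_simps)
  qed (use K(1) L0 M0 b0 in auto)
  then show "\<exists>e>0. \<exists>L. L-lipschitz_on (cball p e \<inter> S) (\<lambda>x. B (F x) (G x))"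
    using d e by (intro exI[of _ "min d e"]) auto
qed

lemma closed_loop_locally_lipschitz:
  fixes f :: "real ^ 'n \<Rightarrow> real ^ 'n" and g :: "real ^ 'n \<Rightarrow> real ^ 'm ^ 'n"
  assumes f: "locally_lipschitz_on UNIV f" and g: "locally_lipschitz_on UNIV g"
    and \<mu>: "feedback_controller U I \<mu>"
  shows "locally_lipschitz_on (UNIV \<times> I) (\<lambda>(y, t). f y + g y *v \<mu> y t)"
proof -
  have fst: "1-lipschitz_on (UNIV \<times> I) (fst :: (real ^ 'n) \<times> real \<Rightarrow> _)"
    by (rule lipschitz_onI) (auto intro: dist_fst_le)
  have "bounded_bilinear ((*v) :: real ^ 'm ^ 'n \<Rightarrow> real ^ 'm \<Rightarrow> real ^ 'n)"
    unfolding bilinear_conv_bounded_bilinear[symmetric] bilinear_def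
    by (auto intro!: linearI simp: matrix_vector_right_distrib matrix_vector_mult_add_rdistrib
        matrix_vector_mult_scaleR scaleR_matrix_vector_assoc)
  moreover have "locally_lipschitz_on (UNIV \<times> I) (\<lambda>q. g (fst q))"
    using g fst by (rule locally_lipschitz_on_compose) simp
  moreover have "locally_lipschitz_on (UNIV \<times> I) (\<lambda>q. case q of (y, t) \<Rightarrow> \<mu> y t)"
    using \<mu> by (simp add: feedback_controller_def)
  ultimately have "locally_lipschitz_on (UNIV \<times> I)
      (\<lambda>q. g (fst q) *v (case q of (y, t) \<Rightarrow> \<mu> y t))"
    by (rule locally_lipschitz_on_bounded_bilinear)
  moreover have "locally_lipschitz_on (UNIV \<times> I) (\<lambda>q. f (fst q))"
    using f fst by (rule locally_lipschitz_on_compose) simp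
  ultimately have "locally_lipschitz_on (UNIV \<times> I)
      (\<lambda>q. f (fst q) + g (fst q) *v (case q of (y, t) \<Rightarrow> \<mu> y t))"
    by (intro locally_lipschitz_on_add)
  then show ?thesis by (simp add: case_prod_beta')
qed

lemma feedback_controller_subset:
  assumes "feedback_controller U I \<mu>" and "I' \<subseteq> I"
  shows "feedback_controller U I' \<mu>"
  using assms locally_lipschitz_on_subset[of "UNIV \<times> I" _ "UNIV \<times> I'"]
  unfolding feedback_controller_def by blast

lemma feedback_controller_hold_after:
  fixes \<kappa> :: "real ^ 'n \<Rightarrow> real \<Rightarrow> real ^ 'm"
  assumes \<kappa>: "feedback_controller U {0..T} \<kappa>" and T: "T > 0"
  shows "feedback_controller U {0..} (hold_after T \<kappa>)"
proof -
  let ?clip = "\<lambda>q::(real ^ 'n) \<times> real. (fst q, min (snd q) T)"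
  have clip: "1-lipschitz_on (UNIV \<times> {0..}) ?clip"
  proof (rule lipschitz_onI)
    fix p q :: "(real ^ 'n) \<times> real"
    have "dist (min (snd p) T) (min (snd q) T) \<le> dist (snd p) (snd q)"
      by (auto simp: dist_real_def)
    then show "dist (fst p, min (snd p) T) (fst q, min (snd q) T) \<le> 1 * dist p q"
      by (simp add: dist_prod_def power_mono)
  qed simp
  have \<kappa>': "locally_lipschitz_on (UNIV \<times> {0..T}) (\<lambda>(y, t). \<kappa> y t)"
    using \<kappa> by (simp add: feedback_controller_def)
  have "?clip ` (UNIV \<times> {0..}) \<subseteq> UNIV \<times> {0..T}"
    using T by auto
  from locally_lipschitz_on_compose[OF \<kappa>' clip this]
  have "locally_lipschitz_on (UNIV \<times> {0..}) (\<lambda>(y, t). hold_after T \<kappa> y t)"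
    by (simp add: hold_after_def case_prod_beta')
  moreover have "hold_after T \<kappa> y t \<in> U" if "t \<in> {0..}" for y t
    using \<kappa> T that by (simp add: feedback_controller_def hold_after_def)
  ultimately show ?thesis by (simp add: feedback_controller_def)
qed

section \<open>Gradients and boundary regularity\<close>

text \<open>The Riesz representation of the derivative guarantees that the definite description defining
  \<^const>\<open>grad\<close> denotes.\<close>

lemma has_derivative_grad:
  fixes h :: "real ^ 'n \<Rightarrow> real"
  assumes "h differentiable (at y)"
  shows "(h has_derivative (\<lambda>w. grad h y \<bullet> w)) (at y)"
proof -
  obtain D where D: "(h has_derivative D) (at y)" using assms unfolding differentiable_def by blast
  then have lin: "linear D" by (rule has_derivative_linear)
  have "D w = w \<bullet> (\<Sum>b\<in>Basis. D b *\<^sub>R b)" for w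
  proof -
    have "D w = D (\<Sum>b\<in>Basis. (w \<bullet> b) *\<^sub>R b)" by (simp add: euclidean_representation)
    also have "\<dots> = (\<Sum>b\<in>Basis. (w \<bullet> b) * D b)"
      by (simp add: linear_sum[OF lin] linear_cmul[OF lin])
    also have "\<dots> = w \<bullet> (\<Sum>b\<in>Basis. D b *\<^sub>R b)"
      by (simp add: inner_sum_right mult.commute)
    finally show ?thesis .
  qed
  then have "D = (\<lambda>w. w \<bullet> (\<Sum>b\<in>Basis. D b *\<^sub>R b))" by blast
  with D have G: "GDERIV h y :> (\<Sum>b\<in>Basis. D b *\<^sub>R b)" unfolding gderiv_def by simp
  then have "grad h y = (\<Sum>b\<in>Basis. D b *\<^sub>R b)" by (rule grad_eqI)
  with G show ?thesis unfolding gderiv_def by (simp add: inner_commute)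
qed

text \<open>At a critical point of \<open>h\<close> the input has no influence on \<open>h\<close>, so the control barrier
  inequality reads \<open>0 \<ge> - \<gamma> (h y)\<close> and rules out \<open>h y < 0\<close>. At level \<open>0\<close> a critical point cannot
  be a frontier point, where \<^const>\<open>Lie_g\<close> does not vanish. Thus every boundary point of a tube,
  whose level is at most \<open>0\<close>, is either a regular point of \<open>h\<close> or interior to the target set.\<close>

lemma cbf_regular:
  fixes f :: "real ^ 'n \<Rightarrow> real ^ 'n" and g :: "real ^ 'n \<Rightarrow> real ^ 'm ^ 'n"
  assumes cbf: "control_barrier_function f g h"
    and Lg: "\<forall>x \<in> frontier (target_set h). Lie_g g h x \<noteq> 0"
    and y: "h y \<le> 0"
  shows "grad h y \<noteq> 0 \<or> y \<in> interior (target_set h)"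
proof (rule disjCI)
  assume ni: "y \<notin> interior (target_set h)"
  show "grad h y \<noteq> 0"
  proof
    assume 0: "grad h y = 0"
    have Lg0: "Lie_g g h y = 0" unfolding Lie_g_def 0 by simp
    have Lf0: "Lie_f f h y = 0" unfolding Lie_f_def 0 by simp
    obtain \<gamma> where \<gamma>: "extended_class_K \<gamma>"
      "(SUP u::real ^ 'm. ereal (Lie_f f h y + Lie_g g h y \<bullet> u)) \<ge> ereal (- \<gamma> (h y))"
      using cbf unfolding control_barrier_function_def by blast
    from \<gamma>(2) have "\<gamma> (h y) \<ge> \<gamma> 0"
      using \<gamma>(1) by (simp add: Lg0 Lf0 extended_class_K_def)
    then have "h y \<ge> 0"
      using \<gamma>(1) unfolding extended_class_K_def by (metis strict_mono_less_eq)
    then have "y \<in> closure (target_set h)"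
      using closure_subset by (fastforce simp: target_set_def)
    with ni have "y \<in> frontier (target_set h)" by (simp add: frontier_def)
    with Lg Lg0 show False by blast
  qed
qed

section \<open>Invariance of a superlevel tube\<close>

text \<open>Coming from positive values, \<open>\<phi>\<close> would have to have a nonpositive derivative at its first
  zero.\<close>

lemma positive_if_increasing_at_zeros:
  fixes \<phi> :: "real \<Rightarrow> real"
  assumes start: "\<phi> a > 0"
    and cont: "continuous_on {a..b} \<phi>"
    and zero: "\<And>t. a < t \<Longrightarrow> t \<le> b \<Longrightarrow> \<phi> t = 0 \<Longrightarrow>
      \<exists>D>0. (\<phi> has_real_derivative D) (at t within {a..b})"
    and t: "t \<in> {a..b}"
  shows "\<phi> t > 0"
proof (rule ccontr)
  assume neg: "\<not> \<phi> t > 0"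
  let ?Z = "{s \<in> {a..b}. \<phi> s = 0}"
  have Z: "\<exists>s\<ge>a. s \<le> u \<and> \<phi> s = 0" if "u \<in> {a..b}" "\<phi> u \<le> 0" for u
    using that start by (intro IVT2') (auto intro: continuous_on_subset[OF cont])
  have "?Z = {a..b} \<inter> \<phi> -` {0}" by auto
  then have "closed ?Z" using continuous_closed_preimage[OF cont] by simp
  moreover have "bounded ?Z" by (rule bounded_subset[of "{a..b}"]) auto
  ultimately have "compact ?Z" by (simp add: compact_eq_bounded_closed)
  moreover have "?Z \<noteq> {}" using Z[of t] t neg by force
  ultimately obtain s where s: "s \<in> ?Z" "\<And>u. u \<in> ?Z \<Longrightarrow> s \<le> u"
    using compact_attains_inf by meson
  have as: "a < s" using s(1) start by (cases "s = a") auto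
  obtain D where D: "D > 0" "(\<phi> has_real_derivative D) (at s within {a..b})"
    using zero[OF as] s(1) by auto
  obtain d where d: "d > 0" "\<And>k. k > 0 \<Longrightarrow> s - k \<in> {a..b} \<Longrightarrow> k < d \<Longrightarrow> \<phi> (s - k) < \<phi> s"
    using has_real_derivative_pos_inc_left[OF D(2,1)] by blast
  define k where "k = min (d / 2) (s - a)"
  have k: "k > 0" "k < d" "s - k \<in> {a..b}" using d(1) as s(1) by (auto simp: k_def)
  have "\<phi> (s - k) \<le> 0" using d(2)[of k] k s(1) by auto
  from Z[OF k(3) this] obtain u where "u \<ge> a" "u \<le> s - k" "\<phi> u = 0" by blast
  with s(2)[of u] k s(1) show False by auto
qed

text \<open>Invariance near a regular boundary point \<open>x a\<close>. Since the boundary inequality is not strict and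
  \<open>h\<close> is merely \<open>C\<^sup>1\<close>, the derivative of \<open>h (x t) + \<rho> t\<close> itself is not controlled once the
  trajectory has left the tube. Instead the trajectory is shifted in the inward direction
  \<open>v = grad h (x a)\<close> by an amount \<open>s(t) = \<epsilon> exp (K (t - a))\<close>. If the shifted point
  \<open>z = x t + s v\<close> lies on the boundary of the tube, the boundary inequality holds at \<open>z\<close>; replacing
  the field at \<open>z\<close> by the field at \<open>x t\<close> costs at most a multiple of \<open>s\<close> by the Lipschitz property,
  and this is outweighed by the growth \<open>K s\<close> of the shift. So the shifted trajectory stays strictly
  inside, and \<open>\<epsilon> \<rightarrow> 0\<close> gives the claim.

  The shifted trajectory starts strictly inside, so it can meet the boundary only after time \<open>a\<close>;
  hence the boundary inequality is asked for only at times after \<open>t0\<close>. This matters at the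
  deadline, after which a barrier continuation satisfies its condition.\<close>

lemma tube_invariance_at_regular_point:
  fixes F :: "real ^ 'n \<Rightarrow> real \<Rightarrow> real ^ 'n" and h :: "real ^ 'n \<Rightarrow> real"
  assumes F: "locally_lipschitz_on (UNIV \<times> {t0..t1}) (\<lambda>(y, t). F y t)"
    and h: "continuously_differentiable h"
    and \<rho>: "\<And>t. t \<in> {t0..t1} \<Longrightarrow> (\<rho> has_real_derivative \<rho>' t) (at t within {t0..t1})"
    and boundary: "\<And>t y. t0 < t \<Longrightarrow> t \<le> t1 \<Longrightarrow> h y + \<rho> t = 0 \<Longrightarrow> grad h y \<bullet> F y t + \<rho>' t \<ge> 0"
    and x: "\<And>t. t \<in> {t0..t1} \<Longrightarrow> (x has_vector_derivative F (x t) t) (at t within {t0..t1})"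
    and a: "t0 \<le> a" "a < t1"
    and start: "h (x a) + \<rho> a \<ge> 0"
    and regular: "grad h (x a) \<noteq> 0"
  shows "\<exists>b>a. b \<le> t1 \<and> (\<forall>t\<in>{a..b}. h (x t) + \<rho> t \<ge> 0)"
proof -
  define p v where "p = x a" and "v = grad h p"
  have v: "norm v > 0" using regular by (simp add: v_def p_def)
  have dh: "(h has_derivative (\<lambda>w. grad h y \<bullet> w)) (at y)" for y
    using h by (intro has_derivative_grad) (simp add: continuously_differentiable_def)
  have conth: "continuous_on S h" for S
    by (meson dh has_derivative_continuous continuous_at_imp_continuous_on)
  have contx: "continuous_on {t0..t1} x"
    using x by (meson has_vector_derivative_continuous continuous_on_eq_continuous_within)
  have cont\<rho>: "continuous_on {t0..t1} \<rho>"
    using \<rho> by (meson DERIV_continuous continuous_on_eq_continuous_within)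
  have "(p, a) \<in> UNIV \<times> {t0..t1}" using a by simp
  with F obtain e1 L where e1: "e1 > 0"
    and L: "L-lipschitz_on (cball (p, a) e1 \<inter> UNIV \<times> {t0..t1}) (\<lambda>(y, t). F y t)"
    unfolding locally_lipschitz_on_def by blast
  have L0: "L \<ge> 0" using L by (rule lipschitz_on_nonneg)
  have "continuous_on UNIV (grad h)" using h by (simp add: continuously_differentiable_def)
  from this[unfolded continuous_on_iff, rule_format, of p "norm v / 2"] v
  obtain e2 where e2: "e2 > 0" "\<And>y. dist y p < e2 \<Longrightarrow> dist (grad h y) v < norm v / 2"
    unfolding v_def[symmetric] by auto
  \<comment> \<open>room for points within \<open>2 * e\<close> in space and within \<open>e\<close> in time\<close>
  define e where "e = min e1 e2 / 4"
  have e: "e > 0" using e1 e2 by (simp add: e_def)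
  have grad_near: "grad h y \<bullet> v \<ge> (norm v)\<^sup>2 / 2" "norm (grad h y) \<le> 2 * norm v"
    if "dist y p \<le> 2 * e" for y
  proof -
    have *: "norm (grad h y - v) \<le> norm v / 2"
      using e2(2)[of y] that e by (force simp: e_def dist_norm)
    have "grad h y \<bullet> v = v \<bullet> v + (grad h y - v) \<bullet> v" by (simp add: inner_diff_left)
    moreover have "\<bar>(grad h y - v) \<bullet> v\<bar> \<le> norm v / 2 * norm v"
      using Cauchy_Schwarz_ineq2[of "grad h y - v" v] mult_right_mono[OF *, of "norm v"] by simp
    ultimately show "grad h y \<bullet> v \<ge> (norm v)\<^sup>2 / 2"
      by (simp add: dot_square_norm power2_eq_square)
    show "norm (grad h y) \<le> 2 * norm v"
      using * norm_triangle_ineq2[of "grad h y" v] v by linarith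
  qed
  have F_near: "norm (F y t - F z t) \<le> L * norm (y - z)"
    if "dist y p \<le> 2 * e" "dist z p \<le> 2 * e" "\<bar>t - a\<bar> \<le> e" "t \<in> {t0..t1}" for y z t
  proof -
    have near: "(w, t) \<in> cball (p, a) e1" if "dist w p \<le> 2 * e" for w
    proof -
      have "dist (p, a) (w, t) \<le> dist p w + dist a t"
        unfolding dist_Pair_Pair by (rule sqrt_sum_squares_le_sum) auto
      also have "\<dots> \<le> 3 * e" using that \<open>\<bar>t - a\<bar> \<le> e\<close> by (simp add: dist_commute dist_real_def)
      finally show ?thesis using e by (simp add: e_def min_def split: if_splits)
    qed
    have "dist (F y t) (F z t) \<le> L * dist (y, t) (z, t)"
      using lipschitz_onD[OF L, of "(y, t)" "(z, t)"] near that by auto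
    then show ?thesis by (simp add: dist_norm dist_Pair_Pair)
  qed
  from contx[unfolded continuous_on_iff, rule_format, of a e] a e
  obtain d where d: "d > 0" "\<And>t. t \<in> {t0..t1} \<Longrightarrow> \<bar>t - a\<bar> < d \<Longrightarrow> dist (x t) p < e"
    unfolding p_def dist_real_def by auto
  define b where "b = Min {t1, a + e, a + d / 2}"
  have b: "a < b" "b \<le> t1" "b \<le> a + e" "b \<le> a + d / 2"
    using a e d(1) by (auto simp: b_def)
  have sub: "{a..b} \<subseteq> {t0..t1}" using a b by auto
  have x_near: "dist (x t) p \<le> e" if "t \<in> {a..b}" for t
    using d(2)[of t] that b sub d(1) by fastforce
  \<comment> \<open>chosen such that the gain \<open>K s (norm v)\<^sup>2 / 2\<close> exceeds the loss \<open>2 (norm v)\<^sup>2 L s\<close>\<close>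
  define K where "K = 4 * L + 1"
  define s where "s \<epsilon> t = \<epsilon> * exp (K * (t - a))" for \<epsilon> t
  define \<phi> where "\<phi> \<epsilon> t = h (x t + s \<epsilon> t *\<^sub>R v) + \<rho> t" for \<epsilon> t
  \<comment> \<open>keeps the shift within \<open>e\<close> up to time \<open>b\<close>\<close>
  define \<epsilon>0 where "\<epsilon>0 = e / (norm v * exp (K * (b - a)))"
  have \<epsilon>0: "\<epsilon>0 > 0" using e v by (simp add: \<epsilon>0_def)
  have K: "K > 0" using L0 by (simp add: K_def)
  have s_small: "s \<epsilon> t * norm v \<le> e" if "0 < \<epsilon>" "\<epsilon> \<le> \<epsilon>0" "t \<in> {a..b}" for \<epsilon> t
  proof -
    have "s \<epsilon> t \<le> \<epsilon>0 * exp (K * (b - a))"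
      unfolding s_def using that K by (intro mult_mono) auto
    then have "s \<epsilon> t * norm v \<le> \<epsilon>0 * exp (K * (b - a)) * norm v" using v by simp
    then show ?thesis using v by (simp add: \<epsilon>0_def)
  qed
  have s_pos: "s \<epsilon> t > 0" if "\<epsilon> > 0" for \<epsilon> t using that by (simp add: s_def)
  have conts: "continuous_on {a..b} (\<lambda>t. x t + s \<epsilon> t *\<^sub>R v)" for \<epsilon>
    unfolding s_def by (intro continuous_intros continuous_on_subset[OF contx sub])
  have cont\<phi>: "continuous_on {a..b} (\<phi> \<epsilon>)" for \<epsilon>
    unfolding \<phi>_def
    by (intro continuous_intros continuous_on_subset[OF cont\<rho> sub]
        continuous_on_compose2[OF conth[of UNIV] conts]) auto
  have pos: "\<phi> \<epsilon> t > 0" if \<epsilon>: "0 < \<epsilon>" "\<epsilon> \<le> \<epsilon>0" and t: "t \<in> {a..b}"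
    and start': "\<phi> \<epsilon> a > 0" for \<epsilon> t
  proof (rule positive_if_increasing_at_zeros[OF start' cont\<phi> _ t])
    fix t assume t: "a < t" "t \<le> b" and zero: "\<phi> \<epsilon> t = 0"
    have tab: "t \<in> {a..b}" and t01: "t \<in> {t0..t1}" using t sub by auto
    define z where "z = x t + s \<epsilon> t *\<^sub>R v"
    define D where "D = grad h z \<bullet> (F (x t) t + (K * s \<epsilon> t) *\<^sub>R v) + \<rho>' t"
    have "(x has_vector_derivative F (x t) t) (at t within {a..b})"
      using x[OF t01] sub by (rule has_vector_derivative_within_subset)
    moreover have ds: "(s \<epsilon> has_real_derivative K * s \<epsilon> t) (at t within {a..b})"
      unfolding s_def by (auto intro!: derivative_eq_intros)
    ultimately have "((\<lambda>t. x t + s \<epsilon> t *\<^sub>R v) has_vector_derivative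
        F (x t) t + (K * s \<epsilon> t) *\<^sub>R v) (at t within {a..b})"
      by (auto intro!: derivative_eq_intros)
    from vector_derivative_diff_chain_within[OF this has_derivative_at_withinI[OF dh]]
    have "((\<lambda>t. h (x t + s \<epsilon> t *\<^sub>R v)) has_real_derivative
        grad h z \<bullet> (F (x t) t + (K * s \<epsilon> t) *\<^sub>R v)) (at t within {a..b})"
      by (simp add: o_def z_def has_real_derivative_iff_has_vector_derivative)
    moreover have "(\<rho> has_real_derivative \<rho>' t) (at t within {a..b})"
      using \<rho>[OF t01] sub by (rule DERIV_subset)
    ultimately have deriv: "(\<phi> \<epsilon> has_real_derivative D) (at t within {a..b})"
      unfolding \<phi>_def D_def by (rule DERIV_add)
    have xp: "dist (x t) p \<le> 2 * e" using x_near[OF tab] e by simp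
    have zx: "norm (x t - z) = s \<epsilon> t * norm v"
      using s_pos[OF \<epsilon>(1)] by (simp add: z_def less_imp_le)
    have zp: "dist z p \<le> 2 * e"
      using dist_triangle[of z p "x t"] x_near[OF tab] zx s_small[OF \<epsilon> tab]
      by (simp add: dist_norm norm_minus_commute)
    have "\<bar>grad h z \<bullet> (F (x t) t - F z t)\<bar> \<le> norm (grad h z) * norm (F (x t) t - F z t)"
      by (rule Cauchy_Schwarz_ineq2)
    also have "\<dots> \<le> (2 * norm v) * (L * (s \<epsilon> t * norm v))"
      using grad_near(2)[OF zp] F_near[OF xp zp _ t01] zx t b by (intro mult_mono) auto
    finally have loss: "grad h z \<bullet> (F (x t) t - F z t) \<ge> - (2 * L * s \<epsilon> t * (norm v)\<^sup>2)"
      by (simp add: power2_eq_square algebra_simps abs_le_iff)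
    have gain: "(K * s \<epsilon> t) * (grad h z \<bullet> v) \<ge> (K * s \<epsilon> t) * ((norm v)\<^sup>2 / 2)"
      using grad_near(1)[OF zp] K s_pos[OF \<epsilon>(1), of t] by (intro mult_left_mono) auto
    have "grad h z \<bullet> F z t + \<rho>' t \<ge> 0"
      using zero t a b by (intro boundary) (auto simp: \<phi>_def z_def)
    moreover have "D = (grad h z \<bullet> F z t + \<rho>' t) + grad h z \<bullet> (F (x t) t - F z t)
        + (K * s \<epsilon> t) * (grad h z \<bullet> v)"
      by (simp add: D_def inner_add_right inner_diff_right)
    ultimately have "D \<ge> s \<epsilon> t * (norm v)\<^sup>2 / 2"
      using loss gain by (simp add: K_def algebra_simps)
    moreover have "s \<epsilon> t * (norm v)\<^sup>2 / 2 > 0" using s_pos[OF \<epsilon>(1)] v by simp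
    ultimately have "D > 0" by linarith
    with deriv show "\<exists>D>0. (\<phi> \<epsilon> has_real_derivative D) (at t within {a..b})" by blast
  qed
  have small: "\<phi> \<epsilon> a > 0" if "0 < \<epsilon>" "\<epsilon> \<le> \<epsilon>0" for \<epsilon>
  proof -
    let ?l = "\<lambda>\<tau>. h (p + \<tau> *\<^sub>R v)"
    have "a \<in> {a..b}" using b by simp
    note s_small[OF that this]
    then have \<epsilon>v: "\<epsilon> * norm v \<le> e" by (simp add: s_def)
    have "?l 0 < ?l \<epsilon>"
    proof (rule DERIV_pos_imp_increasing[OF that(1)])
      fix \<tau> assume \<tau>: "0 \<le> \<tau>" "\<tau> \<le> \<epsilon>"
      have "((\<lambda>\<tau>. p + \<tau> *\<^sub>R v) has_vector_derivative v) (at \<tau>)"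
        by (auto intro!: derivative_eq_intros)
      from vector_derivative_diff_chain_within[OF this has_derivative_at_withinI[OF dh]]
      have "(?l has_real_derivative grad h (p + \<tau> *\<^sub>R v) \<bullet> v) (at \<tau>)"
        by (simp add: o_def has_real_derivative_iff_has_vector_derivative)
      moreover have "grad h (p + \<tau> *\<^sub>R v) \<bullet> v \<ge> (norm v)\<^sup>2 / 2"
        using \<tau> e \<epsilon>v mult_right_mono[OF \<tau>(2), of "norm v"]
        by (intro grad_near) (simp add: dist_norm)
      moreover have "(norm v)\<^sup>2 / 2 > 0" using v by simp
      ultimately show "\<exists>y. (?l has_real_derivative y) (at \<tau>) \<and> 0 < y"
        by (blast intro: less_le_trans)
    qed
    then show ?thesis using start by (simp add: \<phi>_def s_def p_def)
  qed
  have "h (x t) + \<rho> t \<ge> 0" if t: "t \<in> {a..b}" for t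
  proof -
    have "((\<lambda>\<epsilon>. \<phi> \<epsilon> t) \<longlongrightarrow> \<phi> 0 t) (at_right 0)"
    proof -
      have "continuous_on UNIV (\<lambda>\<epsilon>. \<phi> \<epsilon> t)"
        unfolding \<phi>_def s_def
        by (intro continuous_intros continuous_on_compose2[OF conth[of UNIV]]) auto
      then have "((\<lambda>\<epsilon>. \<phi> \<epsilon> t) \<longlongrightarrow> \<phi> 0 t) (at 0)"
        by (simp add: continuous_on_def)
      then show ?thesis by (rule filterlim_mono) (auto simp: at_le)
    qed
    moreover have "eventually (\<lambda>\<epsilon>. \<phi> \<epsilon> t \<ge> 0) (at_right 0)"
      using eventually_at_right_less[of 0] eventually_at_right_real[OF \<epsilon>0]
      by eventually_elim (use pos small t in \<open>auto intro: less_imp_le\<close>)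
    ultimately have "\<phi> 0 t \<ge> 0" by (intro tendsto_lowerbound) auto
    then show ?thesis by (simp add: \<phi>_def s_def)
  qed
  then show ?thesis using b by blast
qed

text \<open>A trajectory that is ever outside the tube has a last time \<open>a\<close> inside it before that, since the
  tube is closed. At \<open>x a\<close> it cannot leave: at positive level by continuity, at a regular point by
  the previous lemma, and at an interior point of the target set because the schedule is
  nonnegative.\<close>

lemma tube_invariance:
  fixes F :: "real ^ 'n \<Rightarrow> real \<Rightarrow> real ^ 'n" and h :: "real ^ 'n \<Rightarrow> real"
  assumes F: "locally_lipschitz_on (UNIV \<times> {t0..t1}) (\<lambda>(y, t). F y t)"
    and h: "continuously_differentiable h"
    and regular: "\<And>y. h y \<le> 0 \<Longrightarrow> grad h y \<noteq> 0 \<or> y \<in> interior (target_set h)"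
    and \<rho>: "\<And>t. t \<in> {t0..t1} \<Longrightarrow> (\<rho> has_real_derivative \<rho>' t) (at t within {t0..t1})"
    and \<rho>_nonneg: "\<And>t. t \<in> {t0..t1} \<Longrightarrow> \<rho> t \<ge> 0"
    and boundary: "\<And>t y. t0 < t \<Longrightarrow> t \<le> t1 \<Longrightarrow> h y + \<rho> t = 0 \<Longrightarrow> grad h y \<bullet> F y t + \<rho>' t \<ge> 0"
    and x: "\<And>t. t \<in> {t0..t1} \<Longrightarrow> (x has_vector_derivative F (x t) t) (at t within {t0..t1})"
    and start: "h (x t0) + \<rho> t0 \<ge> 0"
    and t: "t \<in> {t0..t1}"
  shows "h (x t) + \<rho> t \<ge> 0"
proof (rule ccontr)
  assume out: "\<not> h (x t) + \<rho> t \<ge> 0"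
  define \<psi> where "\<psi> s = h (x s) + \<rho> s" for s
  have conth: "continuous_on UNIV h"
    using h unfolding continuously_differentiable_def
    by (meson differentiable_imp_continuous_within continuous_at_imp_continuous_on)
  have contx: "continuous_on {t0..t1} x"
    using x by (meson has_vector_derivative_continuous continuous_on_eq_continuous_within)
  have cont\<rho>: "continuous_on {t0..t1} \<rho>"
    using \<rho> by (meson DERIV_continuous continuous_on_eq_continuous_within)
  have cont\<psi>: "continuous_on {t0..t1} \<psi>"
    unfolding \<psi>_def by (intro continuous_intros cont\<rho> continuous_on_compose2[OF conth contx]) auto
  let ?Z = "{s \<in> {t0..t}. \<psi> s \<ge> 0}"
  have "?Z = {t0..t} \<inter> \<psi> -` {0..}" by auto
  moreover have "continuous_on {t0..t} \<psi>" using cont\<psi> t by (auto elim: continuous_on_subset)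
  ultimately have "closed ?Z" using continuous_closed_preimage[of "{t0..t}" \<psi> "{0..}"] by simp
  moreover have "bounded ?Z" by (rule bounded_subset[of "{t0..t}"]) auto
  ultimately have "compact ?Z" by (simp add: compact_eq_bounded_closed)
  moreover have "t0 \<in> ?Z" using start t by (simp add: \<psi>_def)
  ultimately obtain a where a: "a \<in> ?Z" "\<And>s. s \<in> ?Z \<Longrightarrow> s \<le> a"
    using compact_attains_sup[of ?Z] by blast
  have "a \<noteq> t" using a(1) out by (auto simp: \<psi>_def)
  with a(1) t have at: "t0 \<le> a" "a < t" "a < t1" "a \<in> {t0..t1}" by auto
  have extend: "\<exists>b>a. \<forall>s\<in>{a..b} \<inter> {t0..t1}. Q s"
    if "eventually Q (at a within {t0..t1})" "Q a" for Q
  proof -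
    from that(1) have "\<exists>d>0. \<forall>s\<in>{t0..t1}. s \<noteq> a \<and> dist s a < d \<longrightarrow> Q s"
      by (simp only: eventually_at)
    then obtain d where d: "d > 0"
      "\<And>s. s \<in> {t0..t1} \<Longrightarrow> s \<noteq> a \<Longrightarrow> dist s a < d \<Longrightarrow> Q s"
      by blast
    have "Q s" if "s \<in> {a..a + d / 2} \<inter> {t0..t1}" for s
      using d(2)[of s] \<open>Q a\<close> d(1) that by (cases "s = a") (auto simp: dist_real_def)
    then show ?thesis using d(1) by (intro exI[of _ "a + d / 2"]) auto
  qed
  have "\<exists>b>a. \<forall>s\<in>{a..b} \<inter> {t0..t1}. \<psi> s \<ge> 0"
  proof (cases "\<psi> a > 0")
    case True
    have "(\<psi> \<longlongrightarrow> \<psi> a) (at a within {t0..t1})" using cont\<psi> at by (simp add: continuous_on_def)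
    from order_tendstoD(1)[OF this True]
    have "\<forall>\<^sub>F s in at a within {t0..t1}. \<psi> s \<ge> 0" by (rule eventually_mono) simp
    then show ?thesis by (rule extend) (use True in simp)
  next
    case False
    then have "h (x a) \<le> 0" using \<rho>_nonneg[OF at(4)] by (simp add: \<psi>_def)
    from regular[OF this] show ?thesis
    proof
      assume reg: "grad h (x a) \<noteq> 0"
      have "h (x a) + \<rho> a \<ge> 0" using a(1) by (simp add: \<psi>_def)
      with F h \<rho> boundary x at(1,3) have "\<exists>b>a. b \<le> t1 \<and> (\<forall>t\<in>{a..b}. h (x t) + \<rho> t \<ge> 0)"
        using reg by (rule tube_invariance_at_regular_point)
      then show ?thesis unfolding \<psi>_def by blast
    next
      assume int: "x a \<in> interior (target_set h)"
      have "(x \<longlongrightarrow> x a) (at a within {t0..t1})" using contx at by (simp add: continuous_on_def)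
      from topological_tendstoD[OF this open_interior int]
      have "\<forall>\<^sub>F s in at a within {t0..t1}. x s \<in> interior (target_set h)" .
      from extend[OF this int] obtain b where b: "b > a"
        "\<And>s. s \<in> {a..b} \<inter> {t0..t1} \<Longrightarrow> x s \<in> interior (target_set h)" by blast
      have "\<psi> s \<ge> 0" if "s \<in> {a..b} \<inter> {t0..t1}" for s
        using b(2)[OF that] interior_subset[of "target_set h"] \<rho>_nonneg[of s] that
        by (force simp: \<psi>_def target_set_def)
      then show ?thesis using b(1) by blast
    qed
  qed
  then obtain b where b: "b > a" "\<And>s. s \<in> {a..b} \<inter> {t0..t1} \<Longrightarrow> \<psi> s \<ge> 0" by blast
  have "min b t \<in> ?Z" using b at t by auto
  from a(2)[OF this] show False using b(1) at by (auto simp: min_def split: if_splits)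
qed

section \<open>Constricting tubes\<close>

lemma closed_loop_trajectory_subinterval:
  assumes x: "closed_loop_trajectory f g \<mu> J x" and t1: "t1 \<in> J" and t0: "0 \<le> t0"
    and t: "t \<in> {t0..t1}"
  shows "(x has_vector_derivative (f (x t) + g (x t) *v \<mu> (x t) t)) (at t within {t0..t1})"
proof -
  have "{t0..t1} \<subseteq> J"
    using x t1 t0 unfolding closed_loop_trajectory_def is_interval_1
    by (meson atLeastAtMost_iff order_trans subsetI)
  then show ?thesis
    using x t unfolding closed_loop_trajectory_def
    by (meson has_vector_derivative_within_subset subsetD)
qed

text \<open>On the boundary of the tube \<open>\<gamma> (h y + \<rho> t) = \<gamma> 0 = 0\<close>, so the controller condition turns into
  the boundary inequality of \<open>tube_invariance\<close>. The schedule \<open>\<rho>\<close> and the initial time are free, to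
  cover both the phase up to the deadline and, with zero schedule, the time after it.\<close>

lemma closed_loop_in_tube:
  fixes f :: "real ^ 'n \<Rightarrow> real ^ 'n" and g :: "real ^ 'n \<Rightarrow> real ^ 'm ^ 'n"
  assumes f_lip: "locally_lipschitz_on UNIV f" and g_lip: "locally_lipschitz_on UNIV g"
    and h_C1: "continuously_differentiable h"
    and h_cbf: "control_barrier_function f g h"
    and Lg_nonzero: "\<forall>x \<in> frontier (target_set h). Lie_g g h x \<noteq> 0"
    and \<gamma>: "extended_class_K \<gamma>"
    and \<mu>: "feedback_controller U {t0..t1} \<mu>"
    and \<rho>: "\<And>t. t \<in> {t0..t1} \<Longrightarrow> (\<rho> has_real_derivative \<rho>' t) (at t within {t0..t1})"
    and \<rho>_nonneg: "\<And>t. t \<in> {t0..t1} \<Longrightarrow> \<rho> t \<ge> 0"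
    and cond: "\<And>t y. t0 < t \<Longrightarrow> t \<le> t1 \<Longrightarrow> h y + \<rho> t \<ge> 0 \<Longrightarrow>
      Lie_f f h y + Lie_g g h y \<bullet> \<mu> y t + \<rho>' t \<ge> - \<gamma> (h y + \<rho> t)"
    and x: "closed_loop_trajectory f g \<mu> J x" and t1: "t1 \<in> J" and t0: "0 \<le> t0" "t0 \<le> t1"
    and start: "h (x t0) + \<rho> t0 \<ge> 0"
  shows "h (x t1) + \<rho> t1 \<ge> 0"
proof (rule tube_invariance[where F = "\<lambda>y t. f y + g y *v \<mu> y t" and h = h and \<rho> = \<rho> and x = x])
  show "locally_lipschitz_on (UNIV \<times> {t0..t1}) (\<lambda>(y, t). f y + g y *v \<mu> y t)"
    using f_lip g_lip \<mu> by (rule closed_loop_locally_lipschitz)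
  show "grad h y \<noteq> 0 \<or> y \<in> interior (target_set h)" if "h y \<le> 0" for y
    using h_cbf Lg_nonzero that by (rule cbf_regular)
  show "grad h y \<bullet> (f y + g y *v \<mu> y t) + \<rho>' t \<ge> 0"
    if "t0 < t" "t \<le> t1" "h y + \<rho> t = 0" for t y
    using cond[of t y] that \<gamma>
    by (simp add: extended_class_K_def Lie_f_def Lie_g_def dot_lmul_matrix inner_add_right)
  show "(x has_vector_derivative f (x t) + g (x t) *v \<mu> (x t) t) (at t within {t0..t1})"
    if "t \<in> {t0..t1}" for t
    using x t1 t0(1) that by (rule closed_loop_trajectory_subinterval)
qed (use h_C1 \<rho> \<rho>_nonneg start t0 in auto)

text \<open>At the deadline the condition on the controller reads
  \<open>Lie_f f h x + Lie_g g h x \<bullet> \<kappa> x T \<ge> - \<gamma> (h x) - rdot T r x0 T\<close> on the target set. Since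
  \<open>rdot T r x0 T \<le> 0\<close>, the final feedback law satisfies the barrier condition of the target set at
  all later times.\<close>

lemma hold_after_barrier_continuation:
  fixes \<kappa> :: "real ^ 'n \<Rightarrow> real \<Rightarrow> real ^ 'm"
  assumes T: "T > 0" and schedule: "relaxation_schedule h x0 T r"
    and \<kappa>: "feedback_controller U {0..T} \<kappa>"
    and cond: "\<forall>t\<in>{0..T}. \<forall>x\<in>tube h r x0 t.
          Lie_f f h x + Lie_g g h x \<bullet> \<kappa> x t + rdot T r x0 t \<ge> - \<gamma> (tube_fun h r x0 x t)"
  shows "barrier_continuation \<gamma> U f g h T \<kappa> (hold_after T \<kappa>)"
  unfolding barrier_continuation_def
proof (intro conjI allI ballI impI)
  show "feedback_controller U {0..} (hold_after T \<kappa>)"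
    using \<kappa> T by (rule feedback_controller_hold_after)
  fix x t
  show "hold_after T \<kappa> x t = \<kappa> x t" if "t \<in> {0..T}" using that by (simp add: hold_after_def)
  assume t: "t > T" and x: "x \<in> target_set h"
  have r: "r x0 T = 0" "rdot T r x0 T \<le> 0"
    using schedule T by (auto simp: relaxation_schedule_def)
  have "Lie_f f h x + Lie_g g h x \<bullet> \<kappa> x T + rdot T r x0 T \<ge> - \<gamma> (tube_fun h r x0 x T)"
    using cond[rule_format, of T x] T x by (simp add: tube_def tube_fun_def target_set_def r(1))
  then show "Lie_f f h x + Lie_g g h x \<bullet> hold_after T \<kappa> x t \<ge> - \<gamma> (h x)"
    using r t by (simp add: hold_after_def tube_fun_def)
qed

theorem theorem1:
  fixes f :: "real ^ 'n \<Rightarrow> real ^ 'n"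
    and g :: "real ^ 'n \<Rightarrow> real ^ 'm ^ 'n"
    and U :: "(real ^ 'm) set"
    and h :: "real ^ 'n \<Rightarrow> real"
    and T :: real
    and x0 :: "real ^ 'n"
    and r :: "real ^ 'n \<Rightarrow> real \<Rightarrow> real"
    and \<gamma> :: "real \<Rightarrow> real"
    and \<kappa> :: "real ^ 'n \<Rightarrow> real \<Rightarrow> real ^ 'm"
  assumes f_lip: "locally_lipschitz_on UNIV f"
    and g_lip: "locally_lipschitz_on UNIV g"
    and h_C1: "continuously_differentiable h"
    and h_cbf: "control_barrier_function f g h"
    and Lg_nonzero: "\<forall>x \<in> frontier (target_set h). Lie_g g h x \<noteq> 0"
    and T_pos: "T > 0"
    and schedule: "relaxation_schedule h x0 T r"
    and ccbf: "constricting_cbf U f g h T r x0"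
    and ccbf_\<gamma>: "constricting_cbf_with \<gamma> U f g h T r x0"
    and controller: "feedback_controller U {0..T} \<kappa>"
    and controller_cond: "\<forall>t\<in>{0..T}. \<forall>x\<in>tube h r x0 t.
          Lie_f f h x + Lie_g g h x \<bullet> \<kappa> x t + rdot T r x0 t \<ge> - \<gamma> (tube_fun h r x0 x t)"
  shows "forward_invariant_on f g \<kappa> T (tube h r x0)
    \<and> (\<forall>x. closed_loop_trajectory f g \<kappa> {0..T} x \<and> x 0 = x0 \<longrightarrow> x T \<in> target_set h)
    \<and> (\<forall>J x. closed_loop_trajectory f g (hold_after T \<kappa>) J x \<and> x 0 = x0 \<longrightarrow>
          (\<forall>t\<in>J. t \<ge> T \<longrightarrow> x t \<in> target_set h))
    \<and> (\<forall>\<mu> J x. barrier_continuation \<gamma> U f g h T \<kappa> \<mu> \<and>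
          closed_loop_trajectory f g \<mu> J x \<and> x 0 = x0 \<longrightarrow>
          (\<forall>t\<in>J. t \<ge> T \<longrightarrow> x t \<in> target_set h))"
proof -
  have \<gamma>: "extended_class_K \<gamma>" using ccbf_\<gamma> by (simp add: constricting_cbf_with_def)
  have r_end: "r x0 T = 0" and x0_tube: "h x0 + r x0 0 \<ge> 0"
    using schedule by (auto simp: relaxation_schedule_def)
  have r_nonneg: "r x0 t \<ge> 0" if "t \<in> {0..T}" for t
    using schedule that by (auto simp: relaxation_schedule_def)
  have r_deriv: "(r x0 has_real_derivative rdot T r x0 t) (at t within {0..T})" if "t \<in> {0..T}" for t
    using schedule that
    by (auto simp: relaxation_schedule_def rdot_def has_real_derivative_iff_has_vector_derivative
        vector_derivative_works)
  have until: "h (x t) + r x0 t \<ge> 0"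
    if x: "closed_loop_trajectory f g \<mu> J x" and agree: "\<forall>x. \<forall>t\<in>{0..T}. \<mu> x t = \<kappa> x t"
      and t: "t \<in> J" "t \<in> {0..T}" and start: "h (x 0) + r x0 0 \<ge> 0" for \<mu> J x t
  proof (rule closed_loop_in_tube[OF f_lip g_lip h_C1 h_cbf Lg_nonzero \<gamma>, where x = x and J = J
        and \<mu> = \<mu> and \<rho> = "r x0" and \<rho>' = "rdot T r x0" and ?t0.0 = 0 and U = U])
    have sub: "{0..t} \<subseteq> {0..T}" using t by auto
    have "feedback_controller U {0..t} \<kappa>" using controller sub by (rule feedback_controller_subset)
    moreover have "locally_lipschitz_on (UNIV \<times> {0..t}) (\<lambda>(x, t). \<mu> x t)
        = locally_lipschitz_on (UNIV \<times> {0..t}) (\<lambda>(x, t). \<kappa> x t)"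
    proof -
      have "L-lipschitz_on (A \<inter> UNIV \<times> {0..t}) (\<lambda>(x, t). \<mu> x t)
          = L-lipschitz_on (A \<inter> UNIV \<times> {0..t}) (\<lambda>(x, t). \<kappa> x t)" for L A
        using agree sub by (intro lipschitz_on_cong) auto
      then show ?thesis by (simp add: locally_lipschitz_on_def)
    qed
    ultimately show "feedback_controller U {0..t} \<mu>"
      using agree sub by (auto simp: feedback_controller_def)
    show "(r x0 has_real_derivative rdot T r x0 s) (at s within {0..t})" if "s \<in> {0..t}" for s
      using r_deriv[of s] that sub by (auto intro: DERIV_subset)
    show "- \<gamma> (h y + r x0 s) \<le> Lie_f f h y + Lie_g g h y \<bullet> \<mu> y s + rdot T r x0 s"
      if "0 < s" "s \<le> t" "h y + r x0 s \<ge> 0" for s y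
      using controller_cond agree that t by (auto simp: tube_def tube_fun_def)
  qed (use x t start r_nonneg in auto)
  have beyond: "x t \<in> target_set h"
    if \<mu>: "barrier_continuation \<gamma> U f g h T \<kappa> \<mu>" and x: "closed_loop_trajectory f g \<mu> J x"
      and x0: "x 0 = x0" and t: "t \<in> J" "t \<ge> T" for \<mu> J x t
  proof -
    have "T \<in> J"
      using x t T_pos unfolding closed_loop_trajectory_def is_interval_1
      by (meson less_imp_le)
    have agree: "\<forall>x. \<forall>t\<in>{0..T}. \<mu> x t = \<kappa> x t" and \<mu>_fb: "feedback_controller U {0..} \<mu>"
      and \<mu>_cond: "\<And>s y. s > T \<Longrightarrow> h y \<ge> 0 \<Longrightarrow> Lie_f f h y + Lie_g g h y \<bullet> \<mu> y s \<ge> - \<gamma> (h y)"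
      using \<mu> by (auto simp: barrier_continuation_def target_set_def)
    have deadline: "h (x T) + r x0 T \<ge> 0"
      using until[OF x agree \<open>T \<in> J\<close>] x0 x0_tube T_pos by simp
    \<comment> \<open>past the deadline the tube is the target set, with the zero schedule\<close>
    have "h (x t) + 0 \<ge> 0"
    proof (rule closed_loop_in_tube[OF f_lip g_lip h_C1 h_cbf Lg_nonzero \<gamma>, where x = x and J = J
          and \<mu> = \<mu> and \<rho> = "\<lambda>_. 0" and \<rho>' = "\<lambda>_. 0" and ?t0.0 = T and U = U])
      show "feedback_controller U {T..t} \<mu>"
        using \<mu>_fb by (rule feedback_controller_subset) (use T_pos in auto)
      show "- \<gamma> (h y + 0) \<le> Lie_f f h y + Lie_g g h y \<bullet> \<mu> y s + 0"
        if "T < s" "s \<le> t" "h y + 0 \<ge> 0" for s y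
        using \<mu>_cond[of s y] that by simp
    qed (use x t T_pos deadline r_end in auto)
    then show ?thesis by (simp add: target_set_def)
  qed
  have "barrier_continuation \<gamma> U f g h T \<kappa> (hold_after T \<kappa>)"
    using T_pos schedule controller controller_cond by (rule hold_after_barrier_continuation)
  moreover have "forward_invariant_on f g \<kappa> T (tube h r x0)"
    using until unfolding forward_invariant_on_def tube_def tube_fun_def by blast
  moreover have "x T \<in> target_set h" if "closed_loop_trajectory f g \<kappa> {0..T} x" "x 0 = x0" for x
    using until[OF that(1), of T] that(2) x0_tube T_pos r_end by (simp add: target_set_def)
  ultimately show ?thesis using beyond by blast
qed

end
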